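(* Let $n_1,\ldots,n_4$ be positive integers such that $n_1 \geq \cdots \geq n_4$. Then the complete $4$-partite graph $K_{n_1,n_2,n_3,n_4}$ is competitively orientable if and only if one of the following holds: (a) $n_1 \geq 4$, $n_3 \geq 3$, and $n_4 = 1$; (b) $n_1 \geq 4$, $n_3 =2$, and $n_4 =2$; (c) $n_3 \geq 3$ and $n_4 \geq 2$.
   Context: All graphs are finite and simple. An orientation of a graph $G$ is a digraph $D$ on the vertex set $V(G)$ with no loops, no multiple arcs and no directed $2$-cycles, whose underlying graph (with edge set $\{uv \mid (u,v)\in A(D)\}$) is $G$. A digraph $D$ is competitive if every pair of distinct vertices $x,y$ has a common out-neighbor, i.e. there is a vertex $z$ with $(x,z),(y,z)\in A(D)$. A graph is competitively orientable if it has a competitive orientation. $K_{n_1,\ldots,n_k}$ denotes the complete $k$-partite graph with partite sets of sizes $n_1,\ldots,n_k$. *)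

theory Defs
  imports "Graph_Theory.Digraph_Component"
begin

text \<open>
  As in \<^theory>\<open>Graph_Theory.Digraph\<close>, a finite simple graph is a symmetric loopfree digraph
  (\<^locale>\<open>pair_graph\<close>), an edge \<open>uv\<close> being the pair of arcs \<open>(u, v)\<close> and \<open>(v, u)\<close>.
  Arcs are pairs of vertices, so multiple arcs cannot occur, and \<^const>\<open>mk_symmetric\<close> maps a
  digraph to its underlying graph on the same vertex set.
\<close>

definition orientation :: "'a pair_pre_digraph \<Rightarrow> 'a pair_pre_digraph \<Rightarrow> bool" where
  "orientation D G \<longleftrightarrow>
     pair_digraph D \<and>
     (\<forall>u v. (u, v) \<in> parcs D \<longrightarrow> (v, u) \<notin> parcs D) \<and>
     mk_symmetric (with_proj D) = G"

definition competitive :: "'a pair_pre_digraph \<Rightarrow> bool" where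
  "competitive D \<longleftrightarrow>
     (\<forall>x\<in>pverts D. \<forall>y\<in>pverts D. x \<noteq> y \<longrightarrow>
        (\<exists>z\<in>pverts D. (x, z) \<in> parcs D \<and> (y, z) \<in> parcs D))"

definition competitively_orientable :: "'a pair_pre_digraph \<Rightarrow> bool" where
  "competitively_orientable G \<longleftrightarrow> (\<exists>D. orientation D G \<and> competitive D)"

text \<open>
  The vertex \<open>(i, j)\<close> is the \<open>j\<close>-th element of the \<open>i\<close>-th partite set, both counted from 0.
\<close>

definition complete_multipartite :: "nat list \<Rightarrow> (nat \<times> nat) pair_pre_digraph" where
  "complete_multipartite ns =
     (let V = (SIGMA i:{..<length ns}. {..<ns ! i})
      in \<lparr> pverts = V, parcs = {(u, v). u \<in> V \<and> v \<in> V \<and> fst u \<noteq> fst v} \<rparr>)"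

lemma pair_graph_complete_multipartite: "pair_graph (complete_multipartite ns)"
proof -
  let ?V = "SIGMA i:{..<length ns}. {..<ns ! i}"
  have "finite ?V" by simp
  moreover have "finite {(u, v). u \<in> ?V \<and> v \<in> ?V \<and> fst u \<noteq> fst v}"
    by (rule finite_subset[of _ "?V \<times> ?V"]) auto
  ultimately show ?thesis
    by unfold_locales (auto simp: complete_multipartite_def Let_def symmetric_def intro!: symI)
qed

end

theory Submission
  imports Defs
begin

text \<open>
  In a competitive orientation every vertex of \<open>N\<^sup>+(x)\<close> has an out-neighbour in \<open>N\<^sup>+(x)\<close>; since
  there are no 2-cycles, an out-neighbourhood that meets only two parts meets both of them at
  least twice. Cloning vertices preserves competitive orientability, so it suffices to orient
  \<open>K\<^bsub>4,3,3,1\<^esub>\<close>, \<open>K\<^bsub>4,2,2,2\<^esub>\<close> and \<open>K\<^bsub>3,3,3,2\<^esub>\<close> explicitly and to exclude \<open>K\<^bsub>m,n,2,1\<^esub>\<close>, \<open>K\<^bsub>3,3,3,1\<^esub>\<close> and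
  \<open>K\<^bsub>3,3,2,2\<^esub>\<close>. In the first and last of these, vertices of different large parts have a
  common out-neighbour among the at most four remaining vertices, which is very restrictive. For
  \<open>K\<^bsub>3,3,3,1\<^esub>\<close> with singleton \<open>w\<close>, counting arcs between two parts shows that \<open>N\<^sup>+(w)\<close> has at most
  three vertices in any two parts together, hence exactly one in each of two parts, and these two
  vertices turn out to have no common out-neighbour.
\<close>

section \<open>Competitive orientations of complete multipartite graphs\<close>

text \<open>The parts are the fibres of \<open>part\<close>, with labels of any type, so that an
  argument can exchange the roles of parts by renaming labels.\<close>

locale competitive_multipartite =
  fixes V :: "'a set" and part :: "'a \<Rightarrow> 'b"
    and arc :: "'a \<Rightarrow> 'a \<Rightarrow> bool"  (infix "\<leadsto>" 50)
  assumes arcD: "u \<leadsto> v \<Longrightarrow> u \<in> V \<and> v \<in> V \<and> part u \<noteq> part v"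
    and arc_total: "u \<in> V \<Longrightarrow> v \<in> V \<Longrightarrow> part u \<noteq> part v \<Longrightarrow> u \<leadsto> v \<or> v \<leadsto> u"
    and arc_asym: "u \<leadsto> v \<Longrightarrow> \<not> v \<leadsto> u"
    and common_out: "x \<in> V \<Longrightarrow> y \<in> V \<Longrightarrow> x \<noteq> y \<Longrightarrow> \<exists>z. x \<leadsto> z \<and> y \<leadsto> z"
begin

text \<open>Arcs inside \<open>S\<close> alternate between \<open>a\<close> and \<open>b\<close>. A
  walk of length two from a vertex of \<open>a\<close> ends in \<open>a\<close> again, at another
  vertex because there are no 2-cycles.\<close>

lemma two_in_part_if_bipartite:
  assumes "S \<noteq> {}" and out: "\<And>s. s \<in> S \<Longrightarrow> \<exists>t\<in>S. s \<leadsto> t"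
    and parts: "\<And>s. s \<in> S \<Longrightarrow> part s = a \<or> part s = b"
  shows "\<exists>u\<in>S. \<exists>v\<in>S. u \<noteq> v \<and> part u = a \<and> part v = a"
proof -
  obtain s t where "s \<in> S" "t \<in> S" "s \<leadsto> t"
    using \<open>S \<noteq> {}\<close> out by blast
  then obtain u where u: "u \<in> S" "part u = a"
    using parts arcD by metis
  then obtain t where t: "t \<in> S" "u \<leadsto> t"
    using out by blast
  then obtain v where v: "v \<in> S" "t \<leadsto> v"
    using out by blast
  have "part v = a"
    using u t v parts arcD by metis
  moreover have "u \<noteq> v"
    using t v arc_asym by blast
  ultimately show ?thesis
    using u v by blast
qed

lemma ex_out:
  assumes "x \<in> V" "y \<in> V" "x \<noteq> y"
  shows "\<exists>z. x \<leadsto> z"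
  using common_out[OF assms] by blast

lemma out_in_out:
  assumes "x \<leadsto> s"
  shows "\<exists>t. x \<leadsto> t \<and> s \<leadsto> t"
  using common_out[of x s] arcD[OF assms] by metis

text \<open>By \<open>out_in_out\<close>, the out-neighbourhood of \<open>x\<close> can serve as the
  set \<open>S\<close> above.\<close>

lemma two_out_in_part_if_bipartite:
  assumes "x \<leadsto> z" and "\<And>s. x \<leadsto> s \<Longrightarrow> part s = a \<or> part s = b"
  shows "\<exists>u v. x \<leadsto> u \<and> x \<leadsto> v \<and> u \<noteq> v \<and> part u = a \<and> part v = a"
proof -
  have "\<exists>u\<in>{s. x \<leadsto> s}. \<exists>v\<in>{s. x \<leadsto> s}. u \<noteq> v \<and> part u = a \<and> part v = a"
    by (rule two_in_part_if_bipartite[of _ a b]) (use assms out_in_out in blast)+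
  then show ?thesis by blast
qed

section \<open>Excluding K_{m,n,2,1}\<close>

text \<open>
  A common out-neighbour \<open>x\<close> of \<open>p\<close> and \<open>w\<close> has \<open>q\<close> as its only out-neighbour among \<open>p, q, w\<close>, so
  the whole opposite large part points to \<open>q\<close>, and \<open>x\<close> and \<open>q\<close> have no common out-neighbour.
\<close>

lemma not_K_m_n_2_1:
  assumes cover: "\<And>v. v \<in> V \<Longrightarrow> part v = i \<or> part v = j \<or> v = p \<or> v = q \<or> v = w"
    and V: "p \<in> V" "q \<in> V" "w \<in> V"
    and parts: "part p = k" "part q = k" "part w = l" "distinct [i, j, k, l]"
    and nonempty: "\<exists>x\<in>V. part x = i" "\<exists>x\<in>V. part x = j"
  shows False
proof -
  \<comment> \<open>\<open>a\<close> and \<open>b\<close> are the two large parts in either order,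
    \<open>a\<close> being the one that contains \<open>x\<close>.\<close>
  have no_common: False
    if x: "p \<leadsto> x" "w \<leadsto> x" "part x = a"
      and ab: "a = i \<and> b = j \<or> a = j \<and> b = i" for x a b
  proof -
    have xV: "x \<in> V" using x arcD by blast
    have into_q: "y \<leadsto> q" and "x \<leadsto> q" if y: "y \<in> V" "part y = b" for y
    proof -
      have "x \<noteq> y" using x y ab parts by auto
      then obtain z where z: "x \<leadsto> z" "y \<leadsto> z"
        using common_out xV y by blast
      then have "z = p \<or> z = q \<or> z = w"
        using cover[of z] arcD[OF z(1)] arcD[OF z(2)] x y ab by auto
      then have "z = q" using z x arc_asym by blast
      then show "y \<leadsto> q" "x \<leadsto> q" using z by auto
    qed
    moreover obtain y where "y \<in> V" "part y = b"
      using nonempty ab by blast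
    ultimately have "x \<leadsto> q" by blast
    then obtain z where z: "x \<leadsto> z" "q \<leadsto> z"
      using out_in_out by blast
    \<comment> \<open>\<open>p\<close> drops out because it lies in the part of \<open>q\<close>.
      Now \<open>z = w\<close> contradicts the arc from \<open>w\<close> to \<open>x\<close>, and a
      \<open>z\<close> in part \<open>b\<close> points to \<open>q\<close> itself.\<close>
    then have "part z = b \<or> z = w"
      using cover[of z] arcD[OF z(1)] arcD[OF z(2)] x ab parts by auto
    then show False
      using z x into_q[of z] arcD[OF z(1)] arc_asym by blast
  qed
  have "p \<noteq> w" using parts by auto
  then obtain x where x: "p \<leadsto> x" "w \<leadsto> x"
    using common_out V by blast
  then have "part x = i \<or> part x = j"
    using cover[of x] arcD[OF x(1)] arcD[OF x(2)] parts by auto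
  then show False using no_common x by blast
qed

section \<open>Excluding K_{3,3,3,1} by counting arcs\<close>

lemma card_out_in_part:
  assumes "finite V"
  shows "card {y. x \<leadsto> y \<and> part y = b} = (\<Sum>y\<in>{v \<in> V. part v = b}. of_bool (x \<leadsto> y))"
proof -
  have "{y. x \<leadsto> y \<and> part y = b} = {v \<in> V. part v = b} \<inter> {y. x \<leadsto> y}"
    using arcD by blast
  then show ?thesis
    using assms by simp
qed

text \<open>Every pair of vertices from the two parts carries exactly one arc, counted at its
  tail.\<close>

lemma arc_count:
  assumes "finite V" "a \<noteq> b"
  shows "(\<Sum>x\<in>{v \<in> V. part v = a}. card {y. x \<leadsto> y \<and> part y = b}) +
         (\<Sum>y\<in>{v \<in> V. part v = b}. card {x. y \<leadsto> x \<and> part x = a}) =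
         card {v \<in> V. part v = a} * card {v \<in> V. part v = b}"  (is "?l = card ?A * card ?B")
proof -
  have "?l = (\<Sum>x\<in>?A. \<Sum>y\<in>?B. of_bool (x \<leadsto> y)) + (\<Sum>x\<in>?A. \<Sum>y\<in>?B. of_bool (y \<leadsto> x))"
    unfolding card_out_in_part[OF \<open>finite V\<close>] by (subst (3) sum.swap) simp
  also have "\<dots> = (\<Sum>x\<in>?A. \<Sum>y\<in>?B. of_bool (x \<leadsto> y) + of_bool (y \<leadsto> x))"
    by (simp only: sum.distrib)
  also have "\<dots> = (\<Sum>x\<in>?A. \<Sum>y\<in>?B. 1)"
  proof (intro sum.cong refl)
    fix x y assume "x \<in> ?A" "y \<in> ?B"
    then have "x \<leadsto> y \<longleftrightarrow> \<not> y \<leadsto> x"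
      using arc_total[of x y] arc_asym[of x y] \<open>a \<noteq> b\<close> by blast
    then show "of_bool (x \<leadsto> y) + of_bool (y \<leadsto> x) = (1::nat)" by simp
  qed
  finally show ?thesis by simp
qed

text \<open>Let c_a be the number of out-neighbours of \<open>w\<close> in part a. Part a sends at
  least 3 + c_a arcs to part b and receives at least 3 + c_b from it, out of 9 in total, so c_a +
  c_b \<le> 3. Since all three numbers are positive, two of them equal 1, which
  \<open>no_singles\<close> refutes.\<close>

lemma not_K3331:
  assumes "finite V" and w: "w \<in> V" "part w \<notin> I" and I: "I = {i, j, k}" "distinct [i, j, k]"
    and cover: "\<And>v. v \<in> V \<Longrightarrow> v \<noteq> w \<Longrightarrow> part v \<in> I"
    and card3: "\<And>a. a \<in> I \<Longrightarrow> card {v \<in> V. part v = a} = 3"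
  shows False
proof -
  let ?C = "\<lambda>a. {v. w \<leadsto> v \<and> part v = a}"
  have fin_out: "finite {y. x \<leadsto> y \<and> part y = b}" for x b
    by (rule finite_subset[OF _ \<open>finite V\<close>]) (use arcD in auto)
  \<comment> \<open>If \<open>w\<close> points to \<open>x\<close>, then the out-neighbours of
    \<open>x\<close> lie in \<open>b\<close> and \<open>c\<close> only, so at least two are in
    \<open>b\<close>. Otherwise there is at least one: without any in \<open>b\<close>, they would
    lie in \<open>c\<close> and the part of \<open>w\<close>, and the latter would need two
    vertices.\<close>
  have out_lower: "1 + (if w \<leadsto> x then 1 else 0) \<le> card {y. x \<leadsto> y \<and> part y = b}"
    if x: "x \<in> V" "part x = a" and abc: "I = {a, b, c}" "distinct [a, b, c]" for x a b c
  proof -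
    have xw: "x \<noteq> w" using x w abc by auto
    obtain z where z: "x \<leadsto> z" using ex_out x w xw by blast
    have parts: "part s = b \<or> part s = c \<or> s = w" if "x \<leadsto> s" for s
      using cover[of s] arcD[OF that] x abc by auto
    show ?thesis
    proof (cases "w \<leadsto> x")
      case True
      then have "\<not> x \<leadsto> w" using arc_asym by blast
      then obtain u v where uv: "x \<leadsto> u" "x \<leadsto> v" "u \<noteq> v" "part u = b" "part v = b"
        using two_out_in_part_if_bipartite[OF z, of b c] parts by blast
      then have "card {u, v} \<le> card {y. x \<leadsto> y \<and> part y = b}"
        by (intro card_mono fin_out) auto
      then show ?thesis using uv True by simp
    next
      case False
      have "{y. x \<leadsto> y \<and> part y = b} \<noteq> {}"
      proof
        assume "{y. x \<leadsto> y \<and> part y = b} = {}"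
        then obtain u v where "x \<leadsto> u" "x \<leadsto> v" "u \<noteq> v" "part u = part w" "part v = part w"
          using two_out_in_part_if_bipartite[OF z, of "part w" c] parts by blast
        then show False using cover w arcD by metis
      qed
      then show ?thesis using fin_out False by (simp add: Suc_le_eq card_gt_0_iff)
    qed
  qed
  have sum_lower: "3 + card (?C a) \<le> (\<Sum>x\<in>{v \<in> V. part v = a}. card {y. x \<leadsto> y \<and> part y = b})"
    if abc: "I = {a, b, c}" "distinct [a, b, c]" for a b c
  proof -
    have "card (?C a) = (\<Sum>x\<in>{v \<in> V. part v = a}. if w \<leadsto> x then 1 else 0)"
      using \<open>finite V\<close> arcD by (simp add: sum.If_cases) (rule arg_cong[of _ _ card], auto)
    moreover have "card {v \<in> V. part v = a} = 3" using card3 abc by auto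
    ultimately have "3 + card (?C a) = (\<Sum>x\<in>{v \<in> V. part v = a}. 1 + (if w \<leadsto> x then 1 else 0))"
      by (simp only: sum.distrib) simp
    also have "\<dots> \<le> (\<Sum>x\<in>{v \<in> V. part v = a}. card {y. x \<leadsto> y \<and> part y = b})"
      using out_lower[OF _ _ abc] by (intro sum_mono) auto
    finally show ?thesis .
  qed
  have pair_le: "card (?C a) + card (?C b) \<le> 3"
    if abc: "I = {a, b, c}" "distinct [a, b, c]" for a b c
  proof -
    have "card {v \<in> V. part v = a} = 3" "card {v \<in> V. part v = b} = 3"
      using card3 abc by auto
    moreover have "I = {b, a, c}" "distinct [b, a, c]"
      using abc by auto
    ultimately show ?thesis
      using arc_count[OF \<open>finite V\<close>, of a b] abc sum_lower[OF abc] sum_lower[of b a c] by auto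
  qed
  obtain z where z: "w \<leadsto> z"
  proof -
    have "{v \<in> V. part v = i} \<noteq> {}" using card3[of i] I by (metis card.empty insertI1 zero_neq_numeral)
    then obtain v where "v \<in> V" "part v = i" by blast
    then show ?thesis using ex_out[of w v] w I that by auto
  qed
  have C_parts: "part s \<in> I" if "w \<leadsto> s" for s
    using cover[of s] arcD[OF that] by auto
  \<comment> \<open>An out-neighbourhood of \<open>w\<close> that misses \<open>a\<close> has at
    least two vertices in each of \<open>b\<close> and \<open>c\<close>, against
    \<open>pair_le\<close>.\<close>
  have C_nonempty: "1 \<le> card (?C a)"
    if abc: "I = {a, b, c}" "distinct [a, b, c]" for a b c
  proof (rule ccontr)
    assume "\<not> 1 \<le> card (?C a)"
    then have "card (?C a) = 0" by simp
    then have "?C a = {}" by (metis card_0_eq fin_out)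
    then have bc: "part s = b \<or> part s = c" if "w \<leadsto> s" for s
      using C_parts[OF that] that abc by blast
    have two: "2 \<le> card (?C d)" if d: "d = b \<and> e = c \<or> d = c \<and> e = b" for d e
    proof -
      obtain u v where uv: "w \<leadsto> u" "w \<leadsto> v" "u \<noteq> v" "part u = d" "part v = d"
        using two_out_in_part_if_bipartite[OF z, of d e] bc d by blast
      then have "card {u, v} \<le> card (?C d)"
        by (intro card_mono fin_out) auto
      then show ?thesis using uv by simp
    qed
    have "I = {b, c, a}" "distinct [b, c, a]" using abc by auto
    then show False using pair_le[of b c a] two[of b c] two[of c b] by auto
  qed
  \<comment> \<open>A common out-neighbour of both singles lies in part \<open>c\<close> and so has no out-neighbour in \<open>N\<^sup>+(w)\<close>.\<close>
  have no_singles: "\<not> (card (?C a) = 1 \<and> card (?C b) = 1)"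
    if abc: "I = {a, b, c}" "distinct [a, b, c]" for a b c
  proof
    assume "card (?C a) = 1 \<and> card (?C b) = 1"
    then obtain u v where uv: "?C a = {u}" "?C b = {v}"
      by (auto simp: card_1_singleton_iff)
    then have arcs: "w \<leadsto> u" "w \<leadsto> v" "part u = a" "part v = b" by auto
    then have "u \<noteq> v" using abc by auto
    then obtain x where x: "u \<leadsto> x" "v \<leadsto> x"
      using common_out arcD arcs by metis
    then have "x \<noteq> w" using arcs arc_asym by blast
    moreover from this have "part x = c"
      using cover[of x] arcD[OF x(1)] arcD[OF x(2)] arcs abc by auto
    ultimately obtain t where t: "x \<leadsto> t" "w \<leadsto> t"
      using common_out w arcD[OF x(1)] by blast
    then have "part t = a \<or> part t = b"
      using C_parts[OF t(2)] arcD[OF t(1)] abc \<open>part x = c\<close> by auto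
    then have "t = u \<or> t = v" using t uv by blast
    then show False using x t arc_asym by blast
  qed
  \<comment> \<open>The facts above mention the labels only through \<open>I = {a, b, c}\<close> and
    distinctness, so they apply to any ordering of the three parts.\<close>
  have perms: "I = {i, j, k}" "distinct [i, j, k]" "I = {i, k, j}" "distinct [i, k, j]"
    "I = {j, k, i}" "distinct [j, k, i]" "I = {k, i, j}" "distinct [k, i, j]"
    using I by auto
  show False
    using C_nonempty[OF perms(1,2)] C_nonempty[OF perms(5,6)] C_nonempty[OF perms(7,8)]
      pair_le[OF perms(1,2)] pair_le[OF perms(3,4)] pair_le[OF perms(5,6)]
      no_singles[OF perms(1,2)] no_singles[OF perms(3,4)] no_singles[OF perms(5,6)]
    by linarith
qed

section \<open>Excluding K_{3,3,2,2}\<close>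

text \<open>
  The remaining 21 undetermined arcs are propositional variables; the instances of
  \<open>common_out\<close> collected below are jointly unsatisfiable.
\<close>

lemma not_K3322_configuration:
  assumes V: "V = {x1, x2, x3, y1, y2, y3, p, q, r, s}"
    and d: "distinct [x1, x2, x3, y1, y2, y3, p, q, r, s]"
    and part: "part x1 = i" "part x2 = i" "part x3 = i" "part y1 = j" "part y2 = j" "part y3 = j"
      "part p = k" "part q = k" "part r = l" "part s = l"
    and ijkl: "distinct [i, j, k, l]"
    and arcs: "x1 \<leadsto> q" "x1 \<leadsto> s" "p \<leadsto> x1" "r \<leadsto> x1"
      "x2 \<leadsto> p" "x2 \<leadsto> r" "q \<leadsto> x2" "s \<leadsto> x2"
      "y1 \<leadsto> q" "y1 \<leadsto> r" "p \<leadsto> y1" "s \<leadsto> y1"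
      "y2 \<leadsto> p" "y2 \<leadsto> s" "q \<leadsto> y2" "r \<leadsto> y2"
  shows False
proof -
  have diff: "i \<noteq> j" "j \<noteq> i" "i \<noteq> k" "k \<noteq> i" "i \<noteq> l" "l \<noteq> i"
    "j \<noteq> k" "k \<noteq> j" "j \<noteq> l" "l \<noteq> j" "k \<noteq> l" "l \<noteq> k"
    using ijkl by auto
  \<comment> \<open>The bounded quantifier and the part inequalities, consequences of
    \<open>arcD\<close>, let each instance expand into a finite disjunction from which candidates in
    the parts of \<open>x\<close> and \<open>y\<close> drop out.\<close>
  have com: "\<exists>z\<in>V. part z \<noteq> part x \<and> part z \<noteq> part y \<and> x \<leadsto> z \<and> y \<leadsto> z"
    if "x \<in> V" "y \<in> V" "x \<noteq> y" for x y
    using common_out[OF that] arcD by metis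
  have flip: "v \<leadsto> u \<longleftrightarrow> \<not> u \<leadsto> v" if "u \<in> V" "v \<in> V" "part u \<noteq> part v" for u v
    using arc_total[OF that] arc_asym by blast
  note c = com[of p q] com[of r s] com[of x1 x2] com[of y1 y2] com[of y1 y3] com[of y2 y3]
    com[of x1 p] com[of x1 r] com[of x2 q] com[of x2 s]
    com[of y1 p] com[of y1 s] com[of y2 q] com[of y2 r]
    com[of x3 p] com[of x3 q] com[of x3 r] com[of x3 s]
    com[of y3 p] com[of y3 q] com[of y3 r] com[of y3 s]
    com[of x3 y1] com[of x3 y2] com[of x3 y3]
  \<comment> \<open>For each undetermined pair one direction is kept as the variable and the other
    becomes its negation.\<close>
  have flips:
    "p \<leadsto> x3 \<longleftrightarrow> \<not> x3 \<leadsto> p" "q \<leadsto> x3 \<longleftrightarrow> \<not> x3 \<leadsto> q" "r \<leadsto> x3 \<longleftrightarrow> \<not> x3 \<leadsto> r" "s \<leadsto> x3 \<longleftrightarrow> \<not> x3 \<leadsto> s"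
    "p \<leadsto> y3 \<longleftrightarrow> \<not> y3 \<leadsto> p" "q \<leadsto> y3 \<longleftrightarrow> \<not> y3 \<leadsto> q" "r \<leadsto> y3 \<longleftrightarrow> \<not> y3 \<leadsto> r" "s \<leadsto> y3 \<longleftrightarrow> \<not> y3 \<leadsto> s"
    "r \<leadsto> p \<longleftrightarrow> \<not> p \<leadsto> r" "s \<leadsto> p \<longleftrightarrow> \<not> p \<leadsto> s" "r \<leadsto> q \<longleftrightarrow> \<not> q \<leadsto> r" "s \<leadsto> q \<longleftrightarrow> \<not> q \<leadsto> s"
    "y1 \<leadsto> x1 \<longleftrightarrow> \<not> x1 \<leadsto> y1" "y2 \<leadsto> x1 \<longleftrightarrow> \<not> x1 \<leadsto> y2" "y3 \<leadsto> x1 \<longleftrightarrow> \<not> x1 \<leadsto> y3"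
    "y1 \<leadsto> x2 \<longleftrightarrow> \<not> x2 \<leadsto> y1" "y2 \<leadsto> x2 \<longleftrightarrow> \<not> x2 \<leadsto> y2" "y3 \<leadsto> x2 \<longleftrightarrow> \<not> x2 \<leadsto> y3"
    "y1 \<leadsto> x3 \<longleftrightarrow> \<not> x3 \<leadsto> y1" "y2 \<leadsto> x3 \<longleftrightarrow> \<not> x3 \<leadsto> y2" "y3 \<leadsto> x3 \<longleftrightarrow> \<not> x3 \<leadsto> y3"
    by (rule flip; simp add: V part diff)+
  note neg = arcs[THEN arc_asym]
  have inV: "x1 \<in> V" "x2 \<in> V" "x3 \<in> V" "y1 \<in> V" "y2 \<in> V" "y3 \<in> V" "p \<in> V" "q \<in> V" "r \<in> V" "s \<in> V"
    by (simp_all add: V)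
  note c' = c[simplified inV d[simplified] simp_thms, OF TrueI TrueI TrueI, unfolded V,
      simplified part diff arcs neg flips bex_simps simp_thms]
  show False using c' by sat
qed

text \<open>A common out-neighbour \<open>x\<close> of \<open>p\<close> and \<open>r\<close> lies in
  a large part. If it missed one of \<open>q\<close> and \<open>s\<close>, the other one,
  \<open>t'\<close>, would be its only out-neighbour among the four; then the whole opposite large
  part would point to \<open>t'\<close>, and \<open>x\<close> and \<open>t'\<close> would have no
  common out-neighbour, as in \<open>not_K_m_n_2_1\<close>.\<close>

lemma avoiding_pair:
  assumes cover: "\<And>v. v \<in> V \<Longrightarrow> part v = i \<or> part v = j \<or> v \<in> {p, q, r, s}"
    and V: "p \<in> V" "q \<in> V" "r \<in> V" "s \<in> V"
    and parts: "part p = k" "part q = k" "part r = l" "part s = l" "distinct [i, j, k, l]"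
    and nonempty: "\<exists>x\<in>V. part x = i" "\<exists>x\<in>V. part x = j"
  shows "\<exists>x. (part x = i \<or> part x = j) \<and> p \<leadsto> x \<and> r \<leadsto> x \<and> x \<leadsto> q \<and> x \<leadsto> s"
proof -
  have "p \<noteq> r" using parts by auto
  then obtain x where x: "p \<leadsto> x" "r \<leadsto> x"
    using common_out V by blast
  then have part_x: "part x = i \<or> part x = j"
    using cover[of x] arcD[OF x(1)] arcD[OF x(2)] parts by auto
  have "x \<leadsto> t"
    if ab: "part x = a" "a = i \<and> b = j \<or> a = j \<and> b = i"
      and t: "t = q \<and> t' = s \<or> t = s \<and> t' = q" for a b t t'
  proof (rule ccontr)
    assume nt: "\<not> x \<leadsto> t"
    have xV: "x \<in> V" using x arcD by blast
    have into: "y \<leadsto> t' \<and> x \<leadsto> t'" if y: "y \<in> V" "part y = b" for y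
    proof -
      have "x \<noteq> y" using ab y parts by auto
      then obtain z where z: "x \<leadsto> z" "y \<leadsto> z"
        using common_out xV y by blast
      then have "z \<in> {p, q, r, s}"
        using cover[of z] arcD[OF z(1)] arcD[OF z(2)] ab y by auto
      then have "z = t'" using z x nt t arc_asym by blast
      then show ?thesis using z by blast
    qed
    moreover obtain y where "y \<in> V" "part y = b"
      using nonempty ab by blast
    ultimately have "x \<leadsto> t'" by blast
    then obtain z where z: "x \<leadsto> z" "t' \<leadsto> z"
      using out_in_out by blast
    then have "part z = b \<or> z \<in> {p, q, r, s}"
      using cover[of z] arcD[OF z(1)] ab by auto
    then consider "part z = b" | "z = t" | "z = t'" | "z = p" | "z = r" using t by blast
    then show False
      using z x nt into[of z] arcD[OF z(1)] arcD[OF z(2)] arc_asym by cases blast+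
  qed
  then have "x \<leadsto> q" "x \<leadsto> s" using part_x by blast+
  then show ?thesis using x part_x by blast
qed

text \<open>The four choices of one vertex from each small part yield, by
  \<open>avoiding_pair\<close>, vertices \<open>x1\<close>, \<open>x2\<close>, \<open>y1\<close>,
  \<open>y2\<close> with known arcs to the small parts. The out-neighbourhoods of \<open>x1\<close>
  and \<open>x2\<close> there are complementary, likewise those of \<open>y1\<close> and
  \<open>y2\<close>, so each pair shares a part. Four vertices do not fit into a part of size 3, so
  the pairs lie in different large parts.\<close>

lemma not_K3322:
  assumes cover: "\<And>v. v \<in> V \<Longrightarrow> part v = i \<or> part v = j \<or> v \<in> {p, q, r, s}"
    and V: "p \<in> V" "q \<in> V" "r \<in> V" "s \<in> V" and pq: "p \<noteq> q" and rs: "r \<noteq> s"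
    and parts: "part p = k" "part q = k" "part r = l" "part s = l" and ijkl: "distinct [i, j, k, l]"
    and card3: "card {v \<in> V. part v = i} = 3" "card {v \<in> V. part v = j} = 3"
  shows False
proof -
  have "{v \<in> V. part v = i} \<noteq> {}" "{v \<in> V. part v = j} \<noteq> {}"
    using card3 by (metis card.empty zero_neq_numeral)+
  then have nonempty: "\<exists>x\<in>V. part x = i" "\<exists>x\<in>V. part x = j"
    by blast+
  obtain x1 where x1: "part x1 = i \<or> part x1 = j" "p \<leadsto> x1" "r \<leadsto> x1" "x1 \<leadsto> q" "x1 \<leadsto> s"
    using avoiding_pair[of i j p q r s k l, OF _ V parts ijkl nonempty] cover by blast
  obtain x2 where x2: "part x2 = i \<or> part x2 = j" "q \<leadsto> x2" "s \<leadsto> x2" "x2 \<leadsto> p" "x2 \<leadsto> r"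
    using avoiding_pair[of i j q p s r k l, OF _ V(2,1,4,3) parts(2,1,4,3) ijkl nonempty] cover by blast
  obtain y1 where y1: "part y1 = i \<or> part y1 = j" "p \<leadsto> y1" "s \<leadsto> y1" "y1 \<leadsto> q" "y1 \<leadsto> r"
    using avoiding_pair[of i j p q s r k l, OF _ V(1,2,4,3) parts(1,2,4,3) ijkl nonempty] cover by blast
  obtain y2 where y2: "part y2 = i \<or> part y2 = j" "q \<leadsto> y2" "r \<leadsto> y2" "y2 \<leadsto> p" "y2 \<leadsto> s"
    using avoiding_pair[of i j q p r s k l, OF _ V(2,1,3,4) parts(2,1,3,4) ijkl nonempty] cover by blast
  \<comment> \<open>Vertices in different large parts have their common out-neighbours among
    \<open>p\<close>, \<open>q\<close>, \<open>r\<close>, \<open>s\<close>.\<close>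
  have same_part: "part u = part v"
    if ab: "part u = i \<or> part u = j" "part v = i \<or> part v = j" and "u \<in> V" "v \<in> V"
      and sep: "\<And>t. t \<in> {p, q, r, s} \<Longrightarrow> \<not> (u \<leadsto> t \<and> v \<leadsto> t)" for u v
  proof (rule ccontr)
    assume "part u \<noteq> part v"
    moreover from this obtain z where z: "u \<leadsto> z" "v \<leadsto> z"
      using common_out \<open>u \<in> V\<close> \<open>v \<in> V\<close> by blast
    ultimately have "z \<in> {p, q, r, s}"
      using cover[of z] arcD[OF z(1)] arcD[OF z(2)] ab by metis
    then show False using z sep by blast
  qed
  have inV: "x1 \<in> V" "x2 \<in> V" "y1 \<in> V" "y2 \<in> V"
    using x1 x2 y1 y2 arcD by blast+
  have px: "part x2 = part x1"
    using same_part[of x2 x1] x1 x2 inV arc_asym by blast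
  have py: "part y2 = part y1"
    using same_part[of y2 y1] y1 y2 inV arc_asym by blast
  have dist: "distinct [x1, x2, y1, y2]"
    using x1 x2 y1 y2 by (auto dest: arc_asym)
  have pxy: "part x1 \<noteq> part y1"
  proof
    assume "part x1 = part y1"
    then have "{x1, x2, y1, y2} \<subseteq> {v \<in> V. part v = part x1}"
      using inV px py by auto
    moreover have card: "card {v \<in> V. part v = part x1} = 3" using x1 card3 by auto
    moreover from this have "finite {v \<in> V. part v = part x1}" by (simp add: card_ge_0_finite)
    ultimately have "card {x1, x2, y1, y2} \<le> 3" by (metis card_mono)
    then show False using dist by simp
  qed
  have third: "\<exists>c. {v \<in> V. part v = part a} = {a, b, c} \<and> c \<noteq> a \<and> c \<noteq> b"
    if "part a = i \<or> part a = j" "part b = part a" "a \<noteq> b" "a \<in> V" "b \<in> V" for a b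
  proof -
    let ?P = "{v \<in> V. part v = part a}"
    have card: "card ?P = 3" using card3 that by auto
    then have "card (?P - {a, b}) = 1"
      using that by (subst card_Diff_subset) auto
    then obtain c where "?P - {a, b} = {c}" by (auto simp: card_1_singleton_iff)
    then show ?thesis using that by (intro exI[of _ c]) auto
  qed
  obtain x3 where x3: "{v \<in> V. part v = part x1} = {x1, x2, x3}" "x3 \<noteq> x1" "x3 \<noteq> x2"
    using third[of x1 x2] x1 px dist inV by auto
  obtain y3 where y3: "{v \<in> V. part v = part y1} = {y1, y2, y3}" "y3 \<noteq> y1" "y3 \<noteq> y2"
    using third[of y1 y2] y1 py dist inV by auto
  have x3': "x3 \<in> V" "part x3 = part x1" and y3': "y3 \<in> V" "part y3 = part y1"
    using x3 y3 by blast+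
  have "V = {x1, x2, x3, y1, y2, y3, p, q, r, s}"
  proof
    show "V \<subseteq> {x1, x2, x3, y1, y2, y3, p, q, r, s}"
    proof
      fix v assume v: "v \<in> V"
      have "part v = part x1 \<or> part v = part y1 \<or> v \<in> {p, q, r, s}"
        using cover[OF v] x1(1) y1(1) pxy by auto
      moreover have "part v = part x1 \<Longrightarrow> v \<in> {x1, x2, x3}" using x3 v by blast
      moreover have "part v = part y1 \<Longrightarrow> v \<in> {y1, y2, y3}" using y3 v by blast
      ultimately show "v \<in> {x1, x2, x3, y1, y2, y3, p, q, r, s}" by blast
    qed
  qed (use inV x3' y3' V in auto)
  moreover have ne: "distinct [part x1, part y1, k, l]"
    using x1(1) y1(1) pxy ijkl by auto
  moreover have "distinct [x1, x2, x3, y1, y2, y3, p, q, r, s]"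
    using x3(2,3) y3(2,3) dist ne pq rs parts px py x3'(2) y3'(2) by auto
  \<comment> \<open>Which of \<open>i\<close> and \<open>j\<close> is the part of \<open>x1\<close>
    is open, so \<open>part x1\<close> and \<open>part y1\<close> themselves serve as
    labels.\<close>
  ultimately show False
    using not_K3322_configuration[of x1 x2 x3 y1 y2 y3 p q r s "part x1" "part y1" k l]
      px py x3'(2) y3'(2) parts x1(2-) x2(2-) y1(2-) y2(2-) by blast
qed

end

section \<open>Passing between orientations of graphs and the locale\<close>

lemma arc_mk_symmetric_iff:
  "(u, v) \<in> parcs (mk_symmetric (with_proj D)) \<longleftrightarrow> (u, v) \<in> parcs D \<or> (v, u) \<in> parcs D"
  by (auto simp: parcs_mk_symmetric Bex_def split_paired_Ex)

text \<open>With \<open>fst\<close> as part function, \<open>arcD\<close> and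
  \<open>arc_total\<close> together say that the underlying graph is the complete multipartite
  one.\<close>

lemma competitively_orientable_iff:
  "competitively_orientable (complete_multipartite ns) \<longleftrightarrow>
     (\<exists>arc. competitive_multipartite (SIGMA i:{..<length ns}. {..<ns ! i}) fst arc)"
    (is "_ \<longleftrightarrow> (\<exists>arc. competitive_multipartite ?V fst arc)")
proof
  assume "competitively_orientable (complete_multipartite ns)"
  then obtain D where asym: "\<And>u v. (u, v) \<in> parcs D \<Longrightarrow> (v, u) \<notin> parcs D"
    and sym: "mk_symmetric (with_proj D) = complete_multipartite ns" and comp: "competitive D"
    unfolding competitively_orientable_def orientation_def by blast
  have verts: "pverts D = ?V"
    using arg_cong[OF sym, of pverts] by (simp add: complete_multipartite_def Let_def)
  have edges: "(u, v) \<in> parcs D \<or> (v, u) \<in> parcs D \<longleftrightarrow> u \<in> ?V \<and> v \<in> ?V \<and> fst u \<noteq> fst v" for u v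
    unfolding arc_mk_symmetric_iff[symmetric] sym by (simp add: complete_multipartite_def Let_def)
  have "competitive_multipartite ?V fst (\<lambda>u v. (u, v) \<in> parcs D)"
  proof
    show "\<exists>z. (x, z) \<in> parcs D \<and> (y, z) \<in> parcs D" if "x \<in> ?V" "y \<in> ?V" "x \<noteq> y" for x y
      using comp that unfolding competitive_def verts by blast
  qed (use edges asym in blast)+
  then show "\<exists>arc. competitive_multipartite ?V fst arc" by blast
next
  assume "\<exists>arc. competitive_multipartite ?V fst arc"
  then obtain arc where "competitive_multipartite ?V fst arc" by blast
  then interpret competitive_multipartite ?V fst arc .
  define D where "D = \<lparr>pverts = ?V, parcs = {(u, v). arc u v}\<rparr>"
  have "finite ?V" by simp
  moreover have "parcs D \<subseteq> ?V \<times> ?V"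
    unfolding D_def by (auto dest: arcD)
  ultimately have "finite (parcs D)"
    by (meson finite_SigmaI finite_subset)
  then have "pair_digraph D"
    by unfold_locales (auto simp: D_def dest: arcD)
  moreover have "mk_symmetric (with_proj D) = complete_multipartite ns"
  proof -
    have "parcs (mk_symmetric (with_proj D)) = {(u, v). arc u v \<or> arc v u}"
      by (auto simp: arc_mk_symmetric_iff D_def)
    moreover have "arc u v \<or> arc v u \<longleftrightarrow> u \<in> ?V \<and> v \<in> ?V \<and> fst u \<noteq> fst v" for u v
      using arcD arc_total by metis
    ultimately show ?thesis
      by (intro pair_pre_digraph.equality) (simp_all add: D_def complete_multipartite_def Let_def)
  qed
  moreover have "(v, u) \<notin> parcs D" if "(u, v) \<in> parcs D" for u v
    using arc_asym that unfolding D_def by simp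
  moreover have "competitive D"
    unfolding competitive_def
  proof (intro ballI impI)
    fix x y assume "x \<in> pverts D" "y \<in> pverts D" "x \<noteq> y"
    then obtain z where "arc x z" "arc y z"
      using common_out[of x y] unfolding D_def by auto
    then show "\<exists>z\<in>pverts D. (x, z) \<in> parcs D \<and> (y, z) \<in> parcs D"
      using arcD[of x z] unfolding D_def by auto
  qed
  ultimately show "competitively_orientable (complete_multipartite ns)"
    unfolding competitively_orientable_def orientation_def by blast
qed

section \<open>Cloning vertices\<close>

text \<open>Arcs are pulled back along the surjection \<open>f\<close>. Vertices with different
  images inherit a common out-neighbour; for clones any out-neighbour of the image will do, and
  \<open>two\<close> ensures that there is one.\<close>

lemma competitive_multipartite_blow_up:
  assumes "competitive_multipartite V part arc"
    and f: "f ` W = V" "\<And>w. w \<in> W \<Longrightarrow> part' w = part (f w)"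
    and two: "\<And>x. x \<in> V \<Longrightarrow> \<exists>y\<in>V. y \<noteq> x"
  shows "competitive_multipartite W part' (\<lambda>u v. u \<in> W \<and> v \<in> W \<and> arc (f u) (f v))"
proof -
  interpret competitive_multipartite V part arc by fact
  show ?thesis
  proof
    fix x y assume xy: "x \<in> W" "y \<in> W" "x \<noteq> y"
    then have fV: "f x \<in> V" "f y \<in> V" using f by auto
    have "\<exists>z. arc (f x) z \<and> arc (f y) z"
      using common_out[OF fV] ex_out[OF fV(1)] two[OF fV(1)] by (cases "f x = f y") auto
    then obtain z where z: "arc (f x) z" "arc (f y) z" by blast
    then obtain w where "w \<in> W" "f w = z" using f arcD by blast
    then show "\<exists>z. (x \<in> W \<and> z \<in> W \<and> arc (f x) (f z)) \<and> y \<in> W \<and> z \<in> W \<and> arc (f y) (f z)"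
      using xy z by blast
  next
    fix u v assume "u \<in> W" "v \<in> W" "part' u \<noteq> part' v"
    then show "(u \<in> W \<and> v \<in> W \<and> arc (f u) (f v)) \<or> (v \<in> W \<and> u \<in> W \<and> arc (f v) (f u))"
      using f arc_total[of "f u" "f v"] by auto
  next
    fix u v assume "u \<in> W \<and> v \<in> W \<and> arc (f u) (f v)"
    then show "u \<in> W \<and> v \<in> W \<and> part' u \<noteq> part' v"
      using f arcD by metis
  qed (use arc_asym in blast)
qed

lemma competitively_orientable_mono:
  assumes ms: "competitively_orientable (complete_multipartite ms)"
    and len: "length ns = length ms" "2 \<le> length ms"
    and le: "\<And>i. i < length ms \<Longrightarrow> 1 \<le> ms ! i \<and> ms ! i \<le> ns ! i"
  shows "competitively_orientable (complete_multipartite ns)"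
proof -
  let ?V = "SIGMA i:{..<length ms}. {..<ms ! i}"
  let ?W = "SIGMA i:{..<length ns}. {..<ns ! i}"
  \<comment> \<open>Surplus vertices of a part become clones of its last vertex, which has index
    \<open>ms ! i - 1\<close> as the part is nonempty.\<close>
  let ?f = "\<lambda>(i, j). (i, min j (ms ! i - 1))"
  obtain arc where arc: "competitive_multipartite ?V fst arc"
    using ms competitively_orientable_iff by blast
  have sub: "?V \<subseteq> ?W" using le len by fastforce
  have "?f ` ?W = ?V"
  proof
    show "?f ` ?W \<subseteq> ?V"
      using le len by (force simp: min_def)
    have "?f v = v" if "v \<in> ?V" for v
      using that by (auto simp: min_def)
    then show "?V \<subseteq> ?f ` ?W"
      using sub by (metis (no_types, lifting) image_eqI subset_eq)
  qed
  moreover have "\<exists>y\<in>?V. y \<noteq> x" for x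
  proof -
    have "0 < length ms" "1 < length ms" using len by auto
    then have "(0, 0) \<in> ?V" "(1, 0) \<in> ?V"
      using le[of 0] le[of 1] by auto
    then show ?thesis by (metis prod.inject zero_neq_one)
  qed
  ultimately have "competitive_multipartite ?W fst (\<lambda>u v. u \<in> ?W \<and> v \<in> ?W \<and> arc (?f u) (?f v))"
    by (intro competitive_multipartite_blow_up[OF arc]) auto
  then show ?thesis using competitively_orientable_iff by blast
qed

lemma competitively_orientable_mono_4:
  assumes "competitively_orientable (complete_multipartite [m1, m2, m3, m4])"
    and "1 \<le> m1" "1 \<le> m2" "1 \<le> m3" "1 \<le> m4" "m1 \<le> n1" "m2 \<le> n2" "m3 \<le> n3" "m4 \<le> n4"
  shows "competitively_orientable (complete_multipartite [n1, n2, n3, n4])"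
proof (rule competitively_orientable_mono[OF assms(1)])
  fix i assume "i < length [m1, m2, m3, m4]"
  then have "i = 0 \<or> i = 1 \<or> i = 2 \<or> i = 3" by simp linarith
  then show "1 \<le> [m1, m2, m3, m4] ! i \<and> [m1, m2, m3, m4] ! i \<le> [n1, n2, n3, n4] ! i"
    using assms(2-) by (elim disjE) simp_all
qed simp_all

section \<open>Explicit orientations as executable certificates\<close>

text \<open>The vertex set as a list, so that \<open>certifies\<close> can be evaluated.\<close>

definition vertices :: "'a list list \<Rightarrow> (nat \<times> nat) list" where
  "vertices L = concat (map (\<lambda>i. map (Pair i) [0..<length (L ! i)]) [0..<length L])"

text \<open>The list \<open>L ! i ! j\<close> consists of the out-neighbours of the vertex \<open>(i, j)\<close>.\<close>

definition certifies :: "(nat \<times> nat) list list list \<Rightarrow> bool" where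
  "certifies L \<longleftrightarrow>
     (\<forall>u\<in>set (vertices L).
        list_all (\<lambda>v. v \<in> set (vertices L)) (L ! fst u ! snd u) \<and>
        (\<forall>v\<in>set (vertices L).
          (if fst u = fst v then v \<notin> set (L ! fst u ! snd u)
           else (v \<in> set (L ! fst u ! snd u)) = (u \<notin> set (L ! fst v ! snd v))) \<and>
          (u \<noteq> v \<longrightarrow> list_ex (\<lambda>z. z \<in> set (L ! fst v ! snd v)) (L ! fst u ! snd u))))"

lemma set_vertices: "set (vertices L) = (SIGMA i:{..<length L}. {..<length (L ! i)})"
  unfolding vertices_def by force

lemma competitively_orientable_if_certifies:
  assumes "certifies L"
  shows "competitively_orientable (complete_multipartite (map length L))"
proof -
  define V where "V = (SIGMA i:{..<length L}. {..<length (L ! i)})"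
  define N where "N u = set (L ! fst u ! snd u)" for u
  have out: "N u \<subseteq> V" if "u \<in> V" for u
    using assms that unfolding certifies_def set_vertices list_all_iff V_def N_def by blast
  have arcs: "if fst u = fst v then v \<notin> N u else v \<in> N u \<longleftrightarrow> u \<notin> N v"
    if "u \<in> V" "v \<in> V" for u v
    using assms that unfolding certifies_def set_vertices V_def N_def by blast
  have comp: "\<exists>z. z \<in> N u \<and> z \<in> N v" if "u \<in> V" "v \<in> V" "u \<noteq> v" for u v
    using assms that unfolding certifies_def set_vertices list_ex_iff V_def N_def by blast
  have "competitive_multipartite V fst (\<lambda>u v. u \<in> V \<and> v \<in> N u)"
  proof
    show "u \<in> V \<and> v \<in> V \<and> fst u \<noteq> fst v" if "u \<in> V \<and> v \<in> N u" for u v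
      using that out[of u] arcs[of u v] by (auto split: if_splits)
    show "\<not> (v \<in> V \<and> u \<in> N v)" if "u \<in> V \<and> v \<in> N u" for u v
      using that arcs[of u v] by (auto split: if_splits)
    show "(u \<in> V \<and> v \<in> N u) \<or> (v \<in> V \<and> u \<in> N v)"
      if "u \<in> V" "v \<in> V" "fst u \<noteq> fst v" for u v
      using that arcs[of u v] by auto
  qed (use comp in blast)
  moreover have V_eq: "V = (SIGMA i:{..<length (map length L)}. {..<map length L ! i})"
    unfolding V_def by auto
  ultimately show ?thesis
    unfolding competitively_orientable_iff V_eq[symmetric] by blast
qed

text \<open>The orientation is invariant under exchanging the indices 0 and 1 in parts 0, 1 and 2
  together with the indices 2 and 3 in part 0.\<close>

lemma competitively_orientable_K4331:
  "competitively_orientable (complete_multipartite [4, 3, 3, 1])"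
proof -
  let ?L = "[
    [[(1, 0), (1, 2), (2, 1), (2, 2)],
     [(1, 1), (1, 2), (2, 0), (2, 2)],
     [(1, 1), (2, 1), (3, 0)],
     [(1, 0), (2, 0), (3, 0)]],
    [[(0, 1), (0, 2), (2, 0), (2, 1)],
     [(0, 0), (0, 3), (2, 0), (2, 1)],
     [(0, 2), (0, 3), (2, 2), (3, 0)]],
    [[(0, 0), (0, 2), (1, 2), (3, 0)],
     [(0, 1), (0, 3), (1, 2), (3, 0)],
     [(0, 2), (0, 3), (1, 0), (1, 1)]],
    [[(0, 0), (0, 1), (1, 0), (1, 1), (2, 2)]]]"
  have "certifies ?L" by code_simp
  then show ?thesis
    using competitively_orientable_if_certifies[of ?L] by (simp add: numeral_eq_Suc)
qed

text \<open>The vertices of part 0 are the binary words of length 3 with an even number of ones,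
  each pointing in part \<open>i\<close> to the vertex indexed by its \<open>i\<close>-th letter;
  part 1 dominates part 3, which dominates part 2, which dominates part 1. Two words agree in one
  letter, and any two letters occur in some word, which serves pairs from different small parts. All
  other pairs meet in a dominated part.\<close>

lemma competitively_orientable_K4222:
  "competitively_orientable (complete_multipartite [4, 2, 2, 2])"
proof -
  let ?L = "[
    [[(1, 1), (2, 1), (3, 0)],
     [(1, 0), (2, 1), (3, 1)],
     [(1, 0), (2, 0), (3, 0)],
     [(1, 1), (2, 0), (3, 1)]],
    [[(0, 0), (0, 3), (3, 0), (3, 1)],
     [(0, 1), (0, 2), (3, 0), (3, 1)]],
    [[(0, 0), (0, 1), (1, 0), (1, 1)],
     [(0, 2), (0, 3), (1, 0), (1, 1)]],
    [[(0, 1), (0, 3), (2, 0), (2, 1)],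
     [(0, 0), (0, 2), (2, 0), (2, 1)]]]"
  have "certifies ?L" by code_simp
  then show ?thesis
    using competitively_orientable_if_certifies[of ?L] by (simp add: numeral_eq_Suc)
qed

lemma competitively_orientable_K3332:
  "competitively_orientable (complete_multipartite [3, 3, 3, 2])"
proof -
  let ?L = "[
    [[(1, 0), (1, 2), (2, 0), (3, 1)],
     [(1, 1), (1, 2), (2, 1), (3, 0)],
     [(1, 0), (2, 1), (2, 2), (3, 1)]],
    [[(0, 1), (2, 1), (3, 0), (3, 1)],
     [(0, 0), (0, 2), (2, 0), (2, 2), (3, 0)],
     [(0, 2), (2, 2), (3, 0), (3, 1)]],
    [[(0, 1), (0, 2), (1, 0), (1, 2)],
     [(0, 0), (1, 1), (1, 2), (3, 1)],
     [(0, 0), (0, 1), (1, 0), (3, 0)]],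
    [[(0, 0), (0, 2), (2, 0), (2, 1)],
     [(0, 1), (1, 1), (2, 0), (2, 2)]]]"
  have "certifies ?L" by code_simp
  then show ?thesis
    using competitively_orientable_if_certifies[of ?L] by (simp add: numeral_eq_Suc)
qed

section \<open>The excluded graphs as instances\<close>

lemma not_competitively_orientable_K_m_n_2_1:
  assumes "1 \<le> n1" "1 \<le> n2" "1 \<le> n3" "n3 \<le> 2"
  shows "\<not> competitively_orientable (complete_multipartite [n1, n2, n3, 1])"
proof
  let ?V = "SIGMA i:{..<length [n1, n2, n3, 1]}. {..<[n1, n2, n3, 1] ! i}"
  assume "competitively_orientable (complete_multipartite [n1, n2, n3, 1])"
  then obtain arc where "competitive_multipartite ?V fst arc"
    using competitively_orientable_iff by blast
  then interpret competitive_multipartite ?V fst arc .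
  show False
  \<comment> \<open>For \<open>n3 = 1\<close> the vertices \<open>p\<close> and \<open>q\<close>
    coincide, which \<open>not_K_m_n_2_1\<close> permits.\<close>
  proof (rule not_K_m_n_2_1[of 0 1 "(2, 0)" "(2, n3 - 1)" "(3, 0)" 2 3])
    show "fst v = 0 \<or> fst v = 1 \<or> v = (2, 0) \<or> v = (2, n3 - 1) \<or> v = (3, 0)"
      if "v \<in> ?V" for v
      using that assms(3,4) by (auto simp: less_Suc_eq numeral_eq_Suc)
    show "\<exists>x\<in>?V. fst x = 0"
      by (rule bexI[of _ "(0, 0)"]) (use assms in simp_all)
    show "\<exists>x\<in>?V. fst x = 1"
      by (rule bexI[of _ "(1, 0)"]) (use assms in simp_all)
  qed (use assms in simp_all)
qed

lemma card_part:
  assumes "a < length ns"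
  shows "card {v \<in> (SIGMA i:{..<length ns}. {..<ns ! i}). fst v = a} = ns ! a"
proof -
  have "{v \<in> (SIGMA i:{..<length ns}. {..<ns ! i}). fst v = a} = Pair a ` {..<ns ! a}"
    using assms by auto
  then show ?thesis by (simp add: card_image inj_on_def)
qed

lemma not_competitively_orientable_K3331:
  "\<not> competitively_orientable (complete_multipartite [3, 3, 3, 1])"
proof
  let ?ns = "[3, 3, 3, 1] :: nat list"
  let ?V = "SIGMA i:{..<length ?ns}. {..<?ns ! i}"
  assume "competitively_orientable (complete_multipartite [3, 3, 3, 1])"
  then obtain arc where "competitive_multipartite ?V fst arc"
    using competitively_orientable_iff by blast
  then interpret competitive_multipartite ?V fst arc .
  show False
  proof (rule not_K3331[of "(3, 0)" "{0, 1, 2}" 0 1 2])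
    show "card {v \<in> ?V. fst v = a} = 3" if "a \<in> {0, 1, 2}" for a
      using that by (subst card_part) auto
  qed (auto simp: less_Suc_eq numeral_eq_Suc)
qed

lemma not_competitively_orientable_K3322:
  "\<not> competitively_orientable (complete_multipartite [3, 3, 2, 2])"
proof
  let ?ns = "[3, 3, 2, 2] :: nat list"
  let ?V = "SIGMA i:{..<length ?ns}. {..<?ns ! i}"
  assume "competitively_orientable (complete_multipartite [3, 3, 2, 2])"
  then obtain arc where "competitive_multipartite ?V fst arc"
    using competitively_orientable_iff by blast
  then interpret competitive_multipartite ?V fst arc .
  show False
  proof (rule not_K3322[of 0 1 "(2, 0)" "(2, 1)" "(3, 0)" "(3, 1)" 2 3])
    show "card {v \<in> ?V. fst v = 0} = 3" "card {v \<in> ?V. fst v = 1} = 3"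
      by (subst card_part; simp)+
  qed (auto simp: less_Suc_eq numeral_eq_Suc)
qed

theorem theorem3:
  fixes n1 n2 n3 n4 :: nat
  assumes "n1 \<ge> n2" and "n2 \<ge> n3" and "n3 \<ge> n4" and "n4 \<ge> 1"
  shows "competitively_orientable (complete_multipartite [n1, n2, n3, n4]) \<longleftrightarrow>
           (n1 \<ge> 4 \<and> n3 \<ge> 3 \<and> n4 = 1) \<or>
           (n1 \<ge> 4 \<and> n3 = 2 \<and> n4 = 2) \<or>
           (n3 \<ge> 3 \<and> n4 \<ge> 2)"
proof
  assume co: "competitively_orientable (complete_multipartite [n1, n2, n3, n4])"
  have "\<not> (n3 \<le> 2 \<and> n4 = 1)"
    using co not_competitively_orientable_K_m_n_2_1[of n1 n2 n3] assms by auto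
  \<comment> \<open>By the ordering no part exceeds 3 vertices, so cloning would make K_{3,3,3,1}
    orientable; K_{3,3,2,2} is reached likewise below.\<close>
  moreover have "\<not> (n1 \<le> 3 \<and> n4 = 1)"
    using competitively_orientable_mono_4[OF co, of 3 3 3 1]
      not_competitively_orientable_K3331 assms by auto
  moreover have "\<not> (n1 \<le> 3 \<and> n3 = 2 \<and> n4 = 2)"
    using competitively_orientable_mono_4[OF co, of 3 3 2 2]
      not_competitively_orientable_K3322 assms by auto
  ultimately show "(n1 \<ge> 4 \<and> n3 \<ge> 3 \<and> n4 = 1) \<or> (n1 \<ge> 4 \<and> n3 = 2 \<and> n4 = 2) \<or> (n3 \<ge> 3 \<and> n4 \<ge> 2)"
    using assms by linarith
next
  assume "(n1 \<ge> 4 \<and> n3 \<ge> 3 \<and> n4 = 1) \<or> (n1 \<ge> 4 \<and> n3 = 2 \<and> n4 = 2) \<or> (n3 \<ge> 3 \<and> n4 \<ge> 2)"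
  then show "competitively_orientable (complete_multipartite [n1, n2, n3, n4])"
  \<comment> \<open>With the ordering, each condition makes the sizes dominate those of one of the
    three explicit graphs.\<close>
  proof (elim disjE)
    assume "n1 \<ge> 4 \<and> n3 \<ge> 3 \<and> n4 = 1"
    then show ?thesis
      by (intro competitively_orientable_mono_4[OF competitively_orientable_K4331])
        (use assms in linarith)+
  next
    assume "n1 \<ge> 4 \<and> n3 = 2 \<and> n4 = 2"
    then show ?thesis
      by (intro competitively_orientable_mono_4[OF competitively_orientable_K4222])
        (use assms in linarith)+
  next
    assume "n3 \<ge> 3 \<and> n4 \<ge> 2"
    then show ?thesis
      by (intro competitively_orientable_mono_4[OF competitively_orientable_K3332])
        (use assms in linarith)+
  qed
qed

end
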